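(* Let $R=D[X;\sigma,\delta]$ be an Ore extension of a skew field $D$ (with $\sigma$ an automorphism of $D$ and $\delta$ a $\sigma$-derivation) satisfying: (1) $R$ is a free module of finite rank $r$ over its center $C$; (2) $C=K[z]$, where $K$ is a commutative subfield of the center of $D$ invariant under $\sigma$ and such that $\delta(K)=0$, and $z\in R$ is a (central) nonconstant polynomial; (3) every nonzero twosided polynomial of $R$ is, up to multiplication by a constant in $D$, of the form $X^m\alpha$ with $\alpha\in K[z]$ and $m\ge0$. Assume that an algorithm for factorizing polynomials in $K[z]$ into irreducibles is available, and that an algorithm FactorizeIrred is available which, given $g\in R$ with $g^*\in K[z]$ irreducible in $K[z]$ (together with $g^*$), returns a list of irreducible polynomials of $R$ whose product, in order, is $g$. Let $f\in R$ have positive degree with $f^*\in K[z]$. Then the algorithm Factorize described in the context correctly factorizes $f$ into a product of irreducibles in $R$: it returns a list of irreducible polynomials $[p_1,\dots,p_l]$ of $R$ with $f=p_1\cdots p_l$.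
   Context: A $\sigma$-derivation is an additive map $\delta:D\to D$ with $\delta(ab)=\sigma(a)\delta(b)+\delta(a)b$. $R=D[X;\sigma,\delta]$ has left $D$-basis $\{X^n:n\ge0\}$ and $Xa=\sigma(a)X+\delta(a)$ for $a\in D$; it is a left and right principal ideal domain. A polynomial $\alpha$ is twosided if $R\alpha=\alpha R$. A bound $f^*$ of $f$ is a polynomial with $Rf^*=f^*R=\operatorname{Ann}_R(R/Rf)$ (the largest twosided ideal contained in $Rf$), determined up to left multiplication by nonzero elements of $D$; "$f^*\in K[z]$" means a bound is chosen in $K[z]$. The right greatest common divisor $(g,h)_r$ is a generator of $Rg+Rh$. Algorithm Factorize. Input $f$. Compute a bound $f^*\in K[z]$ and factorize it as $f^*=\pi_1\cdots\pi_s$ with $\pi_i$ irreducible in $K[z]$. Set $f_1\leftarrow f$. For $i=1,\dots,s-1$: set $f_{i+1}\leftarrow(f_i,\ \pi_{i+1}\cdots\pi_s)_r$ and let $g_i$ be the left quotient, i.e. $f_i=g_if_{i+1}$. Set $g_s\leftarrow f_s$. Return the concatenation, for $i=1,\dots,s$ in this order, of the lists FactorizeIrred$(g_i,\pi_i)$. *)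

theory Defs
  imports "HOL-Computational_Algebra.Polynomial" "HOL-Library.FuncSet"
begin

section \<open>Noncommutative rings\<close>

definition ring_center :: "'a::ring_1 set" where
  "ring_center = {c. \<forall>a. c * a = a * c}"

definition subfield_of_center :: "'a::division_ring set \<Rightarrow> bool" where
  "subfield_of_center K \<longleftrightarrow> K \<subseteq> ring_center \<and> 0 \<in> K \<and> 1 \<in> K \<and>
     (\<forall>a\<in>K. \<forall>b\<in>K. a + b \<in> K \<and> a * b \<in> K) \<and> (\<forall>a\<in>K. - a \<in> K \<and> inverse a \<in> K)"

text \<open>The whole ring, as a module over its subring \<open>C\<close>, has a basis with \<open>r\<close> elements.\<close>

definition free_of_rank_over :: "'a::ring_1 set \<Rightarrow> nat \<Rightarrow> bool" where
  "free_of_rank_over C r \<longleftrightarrow> (\<exists>B :: 'a set. finite B \<and> card B = r \<and>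
     (\<forall>x. \<exists>!c. c \<in> B \<rightarrow>\<^sub>E C \<and> x = (\<Sum>b\<in>B. c b * b)))"

text \<open>Units and irreducible elements of a subring \<open>S\<close>; for the whole ring take \<open>S = UNIV\<close>.\<close>

definition unit_in :: "'a::ring_1 set \<Rightarrow> 'a \<Rightarrow> bool" where
  "unit_in S u \<longleftrightarrow> u \<in> S \<and> (\<exists>v\<in>S. u * v = 1 \<and> v * u = 1)"

definition irreducible_in :: "'a::ring_1 set \<Rightarrow> 'a \<Rightarrow> bool" where
  "irreducible_in S p \<longleftrightarrow> p \<in> S \<and> p \<noteq> 0 \<and> \<not> unit_in S p \<and>
     (\<forall>a\<in>S. \<forall>b\<in>S. p = a * b \<longrightarrow> unit_in S a \<or> unit_in S b)"

definition left_ideal :: "'a::ring_1 \<Rightarrow> 'a set" where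
  "left_ideal f = {a * f | a. True}"

definition right_ideal :: "'a::ring_1 \<Rightarrow> 'a set" where
  "right_ideal f = {f * a | a. True}"

definition twosided :: "'a::ring_1 \<Rightarrow> bool" where
  "twosided f \<longleftrightarrow> left_ideal f = right_ideal f"

text \<open>The annihilator of the left module \<open>R/I\<close>, for a left ideal \<open>I\<close>: the element \<open>a\<close> kills
  the class \<open>x + I\<close> iff \<open>a * x \<in> I\<close>.\<close>

definition ann_quotient :: "'a::ring_1 set \<Rightarrow> 'a set" where
  "ann_quotient I = {a. \<forall>x. a * x \<in> I}"

definition is_bound :: "'a::ring_1 \<Rightarrow> 'a \<Rightarrow> bool" where
  "is_bound f b \<longleftrightarrow> twosided b \<and> left_ideal b = ann_quotient (left_ideal f)"

definition is_right_gcd :: "'a::ring_1 \<Rightarrow> 'a \<Rightarrow> 'a \<Rightarrow> bool" where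
  "is_right_gcd g h d \<longleftrightarrow> left_ideal d = {a + b | a b. a \<in> left_ideal g \<and> b \<in> left_ideal h}"

section \<open>Ore extensions\<close>

text \<open>The type \<open>'d poly\<close> only serves as the type of finitely supported coefficient sequences;
  its multiplication is not used (and does not exist for noncommutative \<open>'d\<close>).\<close>

definition ore_sum :: "('d::zero \<Rightarrow> 'r::ring_1) \<Rightarrow> 'r \<Rightarrow> 'd poly \<Rightarrow> 'r" where
  "ore_sum \<iota> X c = (\<Sum>i\<le>degree c. \<iota> (coeff c i) * X ^ i)"

text \<open>The ring \<open>'r\<close> is \<open>D[X;\<sigma>,\<delta>]\<close>, where \<open>D\<close> is the skew field \<open>'d\<close>, embedded by \<open>\<iota>\<close>.
  Bijectivity of \<^const>\<open>ore_sum\<close> says that the powers of \<open>X\<close> form a left \<open>D\<close>-basis.\<close>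

locale ore_extension =
  fixes \<sigma> \<delta> :: "'d::division_ring \<Rightarrow> 'd" and \<iota> :: "'d \<Rightarrow> 'r::ring_1" and X :: 'r
  assumes \<sigma>_bij: "bij \<sigma>"
    and \<sigma>_one: "\<sigma> 1 = 1"
    and \<sigma>_add: "\<sigma> (a + b) = \<sigma> a + \<sigma> b"
    and \<sigma>_mult: "\<sigma> (a * b) = \<sigma> a * \<sigma> b"
    and \<delta>_add: "\<delta> (a + b) = \<delta> a + \<delta> b"
    and \<delta>_mult: "\<delta> (a * b) = \<sigma> a * \<delta> b + \<delta> a * b"
    and \<iota>_one: "\<iota> 1 = 1"
    and \<iota>_add: "\<iota> (a + b) = \<iota> a + \<iota> b"
    and \<iota>_mult: "\<iota> (a * b) = \<iota> a * \<iota> b"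
    and basis: "bij (ore_sum \<iota> X)"
    and X_mult: "X * \<iota> a = \<iota> (\<sigma> a) * X + \<iota> (\<delta> a)"

definition ore_degree :: "('d::zero \<Rightarrow> 'r::ring_1) \<Rightarrow> 'r \<Rightarrow> 'r \<Rightarrow> nat" where
  "ore_degree \<iota> X p = degree (inv (ore_sum \<iota> X) p)"

definition polys_in :: "('d::zero \<Rightarrow> 'r::ring_1) \<Rightarrow> 'd set \<Rightarrow> 'r \<Rightarrow> 'r set" where
  "polys_in \<iota> K z = {\<Sum>i\<le>n. \<iota> (k i) * z ^ i | (n::nat) k. \<forall>i\<le>n. k i \<in> K}"

section \<open>The algorithm\<close>

text \<open>Indices are shifted by one: \<open>factorize_f gcrd f \<pi>s i\<close> and \<open>factorize_g gcrd lquo f \<pi>s i\<close>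
  are the polynomials \<open>f\<^sub>i\<^sub>+\<^sub>1\<close> and \<open>g\<^sub>i\<^sub>+\<^sub>1\<close>, and \<open>\<pi>s ! i\<close> is \<open>\<pi>\<^sub>i\<^sub>+\<^sub>1\<close>.\<close>

primrec factorize_f :: "('r \<Rightarrow> 'r \<Rightarrow> 'r) \<Rightarrow> 'r::ring_1 \<Rightarrow> 'r list \<Rightarrow> nat \<Rightarrow> 'r" where
  "factorize_f gcrd f \<pi>s 0 = f"
| "factorize_f gcrd f \<pi>s (Suc i) =
     gcrd (factorize_f gcrd f \<pi>s i) (prod_list (drop (Suc i) \<pi>s))"

definition factorize_g ::
  "('r \<Rightarrow> 'r \<Rightarrow> 'r) \<Rightarrow> ('r \<Rightarrow> 'r \<Rightarrow> 'r) \<Rightarrow> 'r::ring_1 \<Rightarrow> 'r list \<Rightarrow> nat \<Rightarrow> 'r" where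
  "factorize_g gcrd lquo f \<pi>s i =
     (if Suc i < length \<pi>s
      then lquo (factorize_f gcrd f \<pi>s i) (factorize_f gcrd f \<pi>s (Suc i))
      else factorize_f gcrd f \<pi>s i)"

text \<open>The subroutines are parameters: \<open>bound\<close> computes bounds, \<open>factor_Kz\<close> factorizes in \<open>K[z]\<close>,
  \<open>gcrd\<close> computes right greatest common divisors, \<open>lquo f h\<close> is the \<open>g\<close> with \<open>f = g * h\<close>, and
  \<open>factorize_irred\<close> is given a polynomial together with its bound.\<close>

definition factorize ::
  "('r \<Rightarrow> 'r) \<Rightarrow> ('r \<Rightarrow> 'r list) \<Rightarrow> ('r \<Rightarrow> 'r \<Rightarrow> 'r) \<Rightarrow> ('r \<Rightarrow> 'r \<Rightarrow> 'r) \<Rightarrow>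
   ('r \<Rightarrow> 'r \<Rightarrow> 'r list) \<Rightarrow> 'r::ring_1 \<Rightarrow> 'r list" where
  "factorize bound factor_Kz gcrd lquo factorize_irred f =
     (let \<pi>s = factor_Kz (bound f)
      in concat (map (\<lambda>i. factorize_irred (factorize_g gcrd lquo f \<pi>s i) (\<pi>s ! i))
           [0..<length \<pi>s]))"

end

theory Submission
  imports Defs
begin

text \<open>
  Let \<open>h\<close> be the right gcd of \<open>f\<close> and \<open>b\<close>, where \<open>a * b\<close> is a central bound of \<open>f\<close>, and write
  \<open>f = g * h\<close>. Multiplying \<open>R h = R f + R b\<close> by \<open>a\<close> lands in \<open>R f\<close>, and cancelling \<open>a\<close> shows that
  \<open>b\<close> is a bound of \<open>h\<close>; likewise multiplying by \<open>b \<in> R h\<close> shows that \<open>a\<close> is a bound of \<open>g\<close>. So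
  the algorithm peels off one irreducible factor of the bound at a time. For this the bound of \<open>f\<close>
  must be nonzero: \<open>f\<close> is algebraic over the center because \<open>R\<close> has finite rank, and since \<open>R\<close> is
  a domain the lowest coefficient of an algebraic relation is a nonzero central element of \<open>R f\<close>.
\<close>

section \<open>Degrees in Ore extensions\<close>

context ore_extension
begin

section \<open>The embedding \<open>\<iota>\<close> and the automorphism
  \<open>\<sigma>\<close>\<close>

lemma \<iota>_zero [simp]: "\<iota> 0 = 0"
  using \<iota>_add[of 0 0] by simp

lemma \<iota>_uminus: "\<iota> (- a) = - \<iota> a"
  using \<iota>_add[of a "- a"] by (simp add: eq_neg_iff_add_eq_0 add.commute)

lemma \<sigma>_eq_0_iff: "\<sigma> a = 0 \<longleftrightarrow> a = 0"
proof -
  have "\<sigma> 0 = 0" using \<sigma>_add[of 0 0] by simp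
  then show ?thesis using bij_is_inj[OF \<sigma>_bij] by (metis injD)
qed

lemma funpow_\<sigma>_eq_0_iff: "(\<sigma> ^^ n) a = 0 \<longleftrightarrow> a = 0"
  by (induction n) (auto simp: \<sigma>_eq_0_iff)

section \<open>Spans of low powers of \<open>X\<close> and leading coefficients\<close>

definition below :: "nat \<Rightarrow> 'r set" where
  "below n = {\<Sum>i<n. \<iota> (k i) * X ^ i | k. True}"

text \<open>The coefficient \<open>a\<close> may be 0, so \<open>n\<close> is only an upper bound
  for the degree. This keeps sums and products free of case distinctions; nonvanishing of
  \<open>a\<close> is assumed separately where it matters.\<close>

definition has_lead :: "nat \<Rightarrow> 'd \<Rightarrow> 'r \<Rightarrow> bool" where
  "has_lead n a p \<longleftrightarrow> p - \<iota> a * X ^ n \<in> below n"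

lemma belowI: "p = (\<Sum>i<n. \<iota> (k i) * X ^ i) \<Longrightarrow> p \<in> below n"
  unfolding below_def by blast

lemma below_0: "p \<in> below 0 \<longleftrightarrow> p = 0"
  unfolding below_def by simp

lemma zero_below: "0 \<in> below n"
  by (rule belowI[of _ "\<lambda>_. 0"]) simp

text \<open>Splitting off the top coefficient makes induction on \<open>n\<close> available without
  appeal to uniqueness of coefficients.\<close>

lemma below_Suc: "p \<in> below (Suc n) \<longleftrightarrow> (\<exists>a. has_lead n a p)"
proof
  assume "p \<in> below (Suc n)"
  then obtain k where "p = (\<Sum>i<Suc n. \<iota> (k i) * X ^ i)"
    unfolding below_def by blast
  then have "p - \<iota> (k n) * X ^ n = (\<Sum>i<n. \<iota> (k i) * X ^ i)"
    by simp
  then show "\<exists>a. has_lead n a p" unfolding has_lead_def by (blast intro: belowI)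
next
  assume "\<exists>a. has_lead n a p"
  then obtain a k where "p - \<iota> a * X ^ n = (\<Sum>i<n. \<iota> (k i) * X ^ i)"
    unfolding has_lead_def below_def by blast
  then have "p = (\<Sum>i<Suc n. \<iota> ((k(n := a)) i) * X ^ i)"
    by (simp add: diff_eq_eq)
  then show "p \<in> below (Suc n)" by (rule belowI)
qed

lemma below_add: "p \<in> below n \<Longrightarrow> q \<in> below n \<Longrightarrow> p + q \<in> below n"
proof -
  assume "p \<in> below n" "q \<in> below n"
  then obtain k l where "p = (\<Sum>i<n. \<iota> (k i) * X ^ i)" "q = (\<Sum>i<n. \<iota> (l i) * X ^ i)"
    unfolding below_def by blast
  then have "p + q = (\<Sum>i<n. \<iota> (k i + l i) * X ^ i)"
    by (simp add: \<iota>_add distrib_right sum.distrib)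
  then show ?thesis by (rule belowI)
qed

lemma below_scale: "p \<in> below n \<Longrightarrow> \<iota> a * p \<in> below n"
proof -
  assume "p \<in> below n"
  then obtain k where "p = (\<Sum>i<n. \<iota> (k i) * X ^ i)"
    unfolding below_def by blast
  then have "\<iota> a * p = (\<Sum>i<n. \<iota> (a * k i) * X ^ i)"
    by (simp add: \<iota>_mult sum_distrib_left mult.assoc)
  then show ?thesis by (rule belowI)
qed

lemma below_uminus: "p \<in> below n \<Longrightarrow> - p \<in> below n"
  using below_scale[of p n "- 1"] by (simp add: \<iota>_uminus \<iota>_one)

lemma has_lead_0_iff: "has_lead n 0 p \<longleftrightarrow> p \<in> below n"
  by (simp add: has_lead_def)

lemma below_mono: "m \<le> n \<Longrightarrow> p \<in> below m \<Longrightarrow> p \<in> below n"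
proof (induction n rule: dec_induct)
  case (step n)
  then show ?case using has_lead_0_iff below_Suc by blast
qed

lemma has_lead_monom: "has_lead n a (\<iota> a * X ^ n)"
  by (simp add: has_lead_def zero_below)

lemma has_lead_add_below: "has_lead n a p \<Longrightarrow> q \<in> below n \<Longrightarrow> has_lead n a (p + q)"
  unfolding has_lead_def using below_add[of "p - \<iota> a * X ^ n" n q] by (simp add: algebra_simps)

lemma has_lead_scale: "has_lead n b q \<Longrightarrow> has_lead n (a * b) (\<iota> a * q)"
  unfolding has_lead_def using below_scale[of "q - \<iota> b * X ^ n" n a]
  by (simp add: right_diff_distrib \<iota>_mult mult.assoc)

text \<open>Moving \<open>X\<close> past \<open>\<iota> a\<close> twists it by
  \<open>\<sigma>\<close> and leaves a \<open>\<delta>\<close> term one degree lower. When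
  \<open>a\<close> is the coefficient of \<open>p\<close> at \<open>X ^ n\<close>, the bracket
  collects everything of degree at most \<open>n\<close>.\<close>

lemma X_mult_split:
  "X * p = \<iota> (\<sigma> a) * X ^ Suc n + (\<iota> (\<delta> a) * X ^ n + X * (p - \<iota> a * X ^ n))"
proof -
  have "X * (\<iota> a * X ^ n) = \<iota> (\<sigma> a) * X ^ Suc n + \<iota> (\<delta> a) * X ^ n"
    unfolding mult.assoc[symmetric] X_mult by (simp add: distrib_right mult.assoc)
  then show ?thesis by (simp add: right_diff_distrib)
qed

lemma X_mult_below: "p \<in> below n \<Longrightarrow> X * p \<in> below (Suc n)"
proof (induction n arbitrary: p)
  case 0
  then show ?case by (simp add: below_0 zero_below)
next
  case (Suc n)
  then obtain a where a: "p - \<iota> a * X ^ n \<in> below n"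
    by (auto simp: below_Suc has_lead_def)
  have "\<iota> (\<delta> a) * X ^ n \<in> below (Suc n)"
    using below_Suc has_lead_monom by blast
  then have "has_lead (Suc n) (\<sigma> a) (X * p)"
    unfolding X_mult_split[of p a n] using Suc.IH[OF a] by (intro has_lead_add_below has_lead_monom below_add)
  then show ?case using below_Suc by blast
qed

lemma X_mult_has_lead: "has_lead n a p \<Longrightarrow> has_lead (Suc n) (\<sigma> a) (X * p)"
proof -
  assume a: "has_lead n a p"
  have "\<iota> (\<delta> a) * X ^ n \<in> below (Suc n)"
    using below_Suc has_lead_monom by blast
  then show ?thesis
    unfolding X_mult_split[of p a n] using X_mult_below a[unfolded has_lead_def]
    by (intro has_lead_add_below has_lead_monom below_add)
qed

lemma X_power_mult_has_lead: "has_lead n a p \<Longrightarrow> has_lead (m + n) ((\<sigma> ^^ m) a) (X ^ m * p)"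
  by (induction m) (simp_all add: X_mult_has_lead mult.assoc)

text \<open>Each term of \<open>p\<close> contributes a shifted, twisted and scaled copy of
  \<open>q\<close>, so peeling off the top term of \<open>p\<close> gives the induction.\<close>

lemma below_mult_has_lead: "p \<in> below m \<Longrightarrow> has_lead n b q \<Longrightarrow> p * q \<in> below (m + n)"
proof (induction m arbitrary: p)
  case 0
  then show ?case by (simp add: below_0 zero_below)
next
  case (Suc m)
  then obtain a where a: "p - \<iota> a * X ^ m \<in> below m"
    by (auto simp: below_Suc has_lead_def)
  have "p * q = \<iota> a * (X ^ m * q) + (p - \<iota> a * X ^ m) * q"
    by (simp add: algebra_simps)
  moreover have "has_lead (m + n) (a * (\<sigma> ^^ m) b) (\<iota> a * (X ^ m * q))"
    using Suc.prems by (intro has_lead_scale X_power_mult_has_lead)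
  ultimately have "has_lead (m + n) (a * (\<sigma> ^^ m) b) (p * q)"
    using has_lead_add_below Suc.IH[OF a Suc.prems(2)] by simp
  then show ?case using below_Suc by auto
qed

text \<open>The top term of \<open>p\<close> alone decides the leading coefficient. For nonzero
  \<open>a\<close> and \<open>b\<close> the resulting coefficient is nonzero, since
  \<open>\<sigma>\<close> is injective and coefficients lie in a skew field.\<close>

lemma has_lead_mult:
  assumes "has_lead m a p" "has_lead n b q"
  shows "has_lead (m + n) (a * (\<sigma> ^^ m) b) (p * q)"
proof -
  have "p * q = \<iota> a * (X ^ m * q) + (p - \<iota> a * X ^ m) * q"
    by (simp add: algebra_simps)
  moreover have "has_lead (m + n) (a * (\<sigma> ^^ m) b) (\<iota> a * (X ^ m * q))"
    using assms by (intro has_lead_scale X_power_mult_has_lead)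
  ultimately show ?thesis
    using has_lead_add_below below_mult_has_lead assms by (simp add: has_lead_def)
qed

section \<open>Comparison with the basis given by \<open>ore_sum\<close>\<close>

lemma ore_sum_eq: "degree c < n \<Longrightarrow> ore_sum \<iota> X c = (\<Sum>i<n. \<iota> (coeff c i) * X ^ i)"
  unfolding ore_sum_def by (rule sum.mono_neutral_left) (auto simp: coeff_eq_0)

text \<open>Presents an arbitrary element of \<open>below n\<close> as a value of
  \<open>ore_sum\<close>, so that its injectivity applies; \<open>Poly\<close> strips trailing
  zeros, hence the degree may drop.\<close>

lemma ore_sum_Poly: "ore_sum \<iota> X (Poly (map k [0..<n])) = (\<Sum>i<n. \<iota> (k i) * X ^ i)"
proof (cases n)
  case (Suc m)
  have "degree (Poly (map k [0..<n])) < n"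
    unfolding Suc
    by (intro le_imp_less_Suc degree_le) (auto simp: coeff_Poly_eq nth_default_def)
  then show ?thesis
    by (subst ore_sum_eq) (auto simp: coeff_Poly_eq nth_default_def intro!: sum.cong)
qed (simp add: ore_sum_def)

lemma ore_sum_has_lead: "has_lead (degree c) (lead_coeff c) (ore_sum \<iota> X c)"
proof -
  have "ore_sum \<iota> X c - \<iota> (lead_coeff c) * X ^ degree c
      = (\<Sum>i<degree c. \<iota> (coeff c i) * X ^ i)"
    unfolding ore_sum_def by (simp add: lessThan_Suc_atMost[symmetric])
  then show ?thesis unfolding has_lead_def by (rule belowI)
qed

lemma ore_degree_has_lead:
  assumes "p \<noteq> 0"
  obtains a where "a \<noteq> 0" "has_lead (ore_degree \<iota> X p) a p"
proof
  define c where "c = inv (ore_sum \<iota> X) p"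
  have p: "ore_sum \<iota> X c = p"
    unfolding c_def using bij_is_surj[OF basis] by (simp add: surj_f_inv_f)
  then have "c \<noteq> 0" using assms by (auto simp: ore_sum_def)
  then show "lead_coeff c \<noteq> 0" by simp
  show "has_lead (ore_degree \<iota> X p) (lead_coeff c) p"
    using ore_sum_has_lead[of c] p by (simp add: ore_degree_def c_def)
qed

text \<open>Otherwise \<open>\<iota> a * X ^ n\<close> would have two coefficient sequences
  differing at index \<open>n\<close>, against injectivity of \<open>ore_sum\<close>.\<close>

lemma has_lead_not_below:
  assumes "has_lead n a p" "a \<noteq> 0"
  shows "p \<notin> below n"
proof
  assume "p \<in> below n"
  then have "\<iota> a * X ^ n \<in> below n"
    using below_add[OF _ below_uminus, of p n "p - \<iota> a * X ^ n"] assms(1)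
    by (simp add: has_lead_def)
  then obtain k where "\<iota> a * X ^ n = (\<Sum>i<n. \<iota> (k i) * X ^ i)"
    unfolding below_def by blast
  moreover have "ore_sum \<iota> X (monom a n) = \<iota> a * X ^ n"
    unfolding ore_sum_def using assms(2)
    by (simp add: degree_monom_eq lessThan_Suc_atMost[symmetric])
  ultimately have "monom a n = Poly (map k [0..<n])"
    using bij_is_inj[OF basis] ore_sum_Poly by (metis injD)
  then have "coeff (monom a n) n = coeff (Poly (map k [0..<n])) n" by simp
  then show False using assms(2) by (simp add: coeff_Poly_eq nth_default_def)
qed

text \<open>Nonzero leading coefficients multiply to a nonzero one, so the product lies outside a
  span that contains 0.\<close>

lemma ore_no_zero_divisors:
  fixes p q :: 'r
  assumes "p * q = 0"
  shows "p = 0 \<or> q = 0"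
proof (rule ccontr)
  assume "\<not> ?thesis"
  then obtain a b where ab: "a \<noteq> 0" "has_lead (ore_degree \<iota> X p) a p"
      "b \<noteq> 0" "has_lead (ore_degree \<iota> X q) b q"
    using ore_degree_has_lead by metis
  have "p * q \<notin> below (ore_degree \<iota> X p + ore_degree \<iota> X q)"
    using has_lead_not_below[OF has_lead_mult[OF ab(2,4)]] ab(1,3)
    by (simp add: funpow_\<sigma>_eq_0_iff)
  then show False using assms below_0 below_mono by auto
qed

text \<open>Degrees add, so a product equal to 1 would have positive degree, whereas 1 lies in
  \<open>below 1\<close>.\<close>

lemma positive_degree_not_left_invertible:
  assumes "ore_degree \<iota> X f > 0" "f \<noteq> 0"
  shows "v * f \<noteq> 1"
proof
  assume vf: "v * f = 1"
  then have "v \<noteq> 0" by auto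
  then obtain a b where ab: "a \<noteq> 0" "has_lead (ore_degree \<iota> X v) a v"
      "b \<noteq> 0" "has_lead (ore_degree \<iota> X f) b f"
    using ore_degree_has_lead assms(2) by metis
  have "1 \<notin> below (ore_degree \<iota> X v + ore_degree \<iota> X f)"
    using has_lead_not_below[OF has_lead_mult[OF ab(2,4)]] ab(1,3) vf
    by (simp add: funpow_\<sigma>_eq_0_iff)
  moreover have "1 \<in> below (Suc 0)"
    by (rule belowI[of _ "\<lambda>_. 1"]) (simp add: \<iota>_one)
  ultimately show False using below_mono assms(1)
    by (metis Suc_leI add_gr_0)
qed

lemma positive_degree_nonzero: "ore_degree \<iota> X f > 0 \<Longrightarrow> f \<noteq> 0"
proof
  assume "ore_degree \<iota> X f > 0" "f = 0"
  moreover have "inv (ore_sum \<iota> X) 0 = 0"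
    by (rule inv_f_eq[OF bij_is_inj[OF basis]]) (simp add: ore_sum_def)
  ultimately show False by (simp add: ore_degree_def)
qed

end

section \<open>Nonzero bounds\<close>

lemma ring_center_commute: "c \<in> ring_center \<Longrightarrow> c * x = x * c"
  by (simp add: ring_center_def)

lemma ring_center_mult:
  assumes "a \<in> ring_center" "b \<in> ring_center"
  shows "a * b \<in> ring_center"
  using assms unfolding ring_center_def mem_Collect_eq by (metis mult.assoc)

lemma ring_center_diff:
  "a \<in> ring_center \<Longrightarrow> b \<in> ring_center \<Longrightarrow> a - b \<in> ring_center"
  by (simp add: ring_center_def left_diff_distrib right_diff_distrib)

lemma ring_center_uminus: "a \<in> ring_center \<Longrightarrow> - a \<in> ring_center"
  by (simp add: ring_center_def)

lemma ring_center_1: "1 \<in> ring_center"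
  by (simp add: ring_center_def)

lemma ring_center_sum:
  "(\<And>j. j \<in> J \<Longrightarrow> h j \<in> ring_center) \<Longrightarrow> sum h J \<in> ring_center"
  by (simp add: ring_center_def sum_distrib_left sum_distrib_right)

lemma ring_center_prod_list:
  "set xs \<subseteq> ring_center \<Longrightarrow> prod_list xs \<in> ring_center"
  by (induction xs) (auto simp: ring_center_1 ring_center_mult)

text \<open>Gaussian elimination without fractions: the center is a commutative domain but need not
  be a field, so rows are multiplied by the pivot instead of divided by it. Rows are indexed by
  \<open>J\<close>, columns by \<open>B\<close>.\<close>

lemma linear_dependence_over_center:
  fixes v :: "'j \<Rightarrow> 'b \<Rightarrow> 'r::ring_1"
  assumes nzd: "\<And>a b :: 'r. a * b = 0 \<Longrightarrow> a = 0 \<or> b = 0"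
    and "finite B" "finite J" "card B < card J"
    and "\<And>j b. j \<in> J \<Longrightarrow> b \<in> B \<Longrightarrow> v j b \<in> ring_center"
  shows "\<exists>c. (\<forall>j. c j \<in> ring_center) \<and> (\<exists>j\<in>J. c j \<noteq> 0) \<and> (\<forall>b\<in>B. (\<Sum>j\<in>J. c j * v j b) = 0)"
  using assms(2-)
proof (induction B arbitrary: J v rule: finite_induct)
  case empty
  then have "J \<noteq> {}" by auto
  then show ?case by (intro exI[of _ "\<lambda>_. 1"]) (auto simp: ring_center_1)
next
  case (insert b B)
  show ?case
  proof (cases "\<forall>j\<in>J. v j b = 0")
    case True
    have "\<exists>c. (\<forall>j. c j \<in> ring_center) \<and> (\<exists>j\<in>J. c j \<noteq> 0) \<and> (\<forall>b\<in>B. (\<Sum>j\<in>J. c j * v j b) = 0)"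
      using insert.prems insert.hyps by (intro insert.IH) auto
    then show ?thesis using True by auto
  next
    case False
    then obtain j0 where j0: "j0 \<in> J" "v j0 b \<noteq> 0" by blast
    define J' where "J' = J - {j0}"
    \<comment> \<open>Row \<open>j0\<close> is the pivot. The eliminated rows \<open>w\<close>
      vanish in column \<open>b\<close> because central entries commute, so a dependence in the
      columns \<open>B\<close> suffices.\<close>
    define w where "w j b' = v j0 b * v j b' - v j b * v j0 b'" for j b'
    have J': "finite J'" "j0 \<notin> J'" "J = insert j0 J'"
      using insert.prems j0 by (auto simp: J'_def)
    have "\<exists>c. (\<forall>j. c j \<in> ring_center) \<and> (\<exists>j\<in>J'. c j \<noteq> 0) \<and>
        (\<forall>b\<in>B. (\<Sum>j\<in>J'. c j * w j b) = 0)"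
    proof (rule insert.IH)
      show "card B < card J'" using insert.prems insert.hyps J' by simp
      show "w j b' \<in> ring_center" if "j \<in> J'" "b' \<in> B" for j b'
        unfolding w_def using that insert.prems(3) J'(3)
        by (intro ring_center_diff ring_center_mult) auto
    qed (use J' in auto)
    then obtain c where c: "\<And>j. c j \<in> ring_center" "\<exists>j\<in>J'. c j \<noteq> 0"
        "\<And>b'. b' \<in> B \<Longrightarrow> (\<Sum>j\<in>J'. c j * w j b') = 0" by blast
    \<comment> \<open>Expanding \<open>w\<close> in a dependence of the eliminated rows yields these
      coefficients for the original rows; multiplying by the nonzero pivot keeps the dependence
      nontrivial.\<close>
    define c' where "c' j = (if j = j0 then - (\<Sum>j\<in>J'. c j * v j b) else c j * v j0 b)" for j
    have vc: "v j b \<in> ring_center" if "j \<in> J" for j using insert.prems(3) that by simp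
    have rel: "(\<Sum>j\<in>J. c' j * v j b') = (\<Sum>j\<in>J'. c j * w j b')" for b'
    proof -
      have "(\<Sum>j\<in>J. c' j * v j b') = c' j0 * v j0 b' + (\<Sum>j\<in>J'. c' j * v j b')"
        using J' by simp
      also have "(\<Sum>j\<in>J'. c' j * v j b') = (\<Sum>j\<in>J'. c j * v j0 b * v j b')"
        using J'(2) by (intro sum.cong) (auto simp: c'_def)
      also have "c' j0 * v j0 b' = - (\<Sum>j\<in>J'. c j * v j b * v j0 b')"
        by (simp add: c'_def sum_distrib_right)
      finally show ?thesis
        by (simp add: w_def right_diff_distrib sum_subtractf mult.assoc)
    qed
    have "(\<Sum>j\<in>J. c' j * v j b') = 0" if "b' \<in> insert b B" for b'
    proof (cases "b' = b")
      case True
      then show ?thesis unfolding rel w_def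
        using ring_center_commute[OF vc[OF j0(1)]] by (intro sum.neutral) simp
    qed (use that rel c(3) in auto)
    moreover have "\<exists>j\<in>J. c' j \<noteq> 0"
      using c(2) J' j0(2) nzd unfolding c'_def by (metis insert_iff)
    moreover have "c' j \<in> ring_center" for j
      unfolding c'_def using c(1) vc j0(1) J'(3)
      by (auto intro!: ring_center_uminus ring_center_sum ring_center_mult)
    ultimately show ?thesis by blast
  qed
qed

lemma nonzero_central_multiple:
  fixes f :: "'r::ring_1"
  assumes nzd: "\<And>a b :: 'r. a * b = 0 \<Longrightarrow> a = 0 \<or> b = 0"
    and free: "free_of_rank_over (ring_center :: 'r set) r"
    and "f \<noteq> 0"
  shows "\<exists>c\<in>ring_center. c \<noteq> 0 \<and> c \<in> left_ideal f"
proof -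
  obtain B :: "'r set" where B: "finite B"
    "\<And>x. \<exists>c. c \<in> B \<rightarrow>\<^sub>E ring_center \<and> x = (\<Sum>b\<in>B. c b * b)"
    using free unfolding free_of_rank_over_def by metis
  obtain e where e: "\<And>x. e x \<in> B \<rightarrow>\<^sub>E ring_center" "\<And>x. x = (\<Sum>b\<in>B. e x b * b)"
    using B(2) by metis
  \<comment> \<open>The exponents 0 to \<open>card B\<close> give one more power of \<open>f\<close>
    than there are basis elements; the rows are the coordinate vectors of these powers.\<close>
  have "\<exists>c. (\<forall>j. c j \<in> ring_center) \<and> (\<exists>j\<in>{..card B}. c j \<noteq> 0) \<and>
      (\<forall>b\<in>B. (\<Sum>j\<in>{..card B}. c j * e (f ^ j) b) = 0)"
    using e(1) by (intro linear_dependence_over_center nzd B(1)) auto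
  then obtain c where c: "\<And>j. c j \<in> ring_center" "\<exists>j\<le>card B. c j \<noteq> 0"
      "\<And>b. b \<in> B \<Longrightarrow> (\<Sum>j\<le>card B. c j * e (f ^ j) b) = 0" by blast
  have "(\<Sum>j\<le>card B. c j * f ^ j) = (\<Sum>j\<le>card B. \<Sum>b\<in>B. c j * e (f ^ j) b * b)"
    by (subst (1) e(2)) (simp add: sum_distrib_left mult.assoc)
  also have "\<dots> = (\<Sum>b\<in>B. (\<Sum>j\<le>card B. c j * e (f ^ j) b) * b)"
    by (subst sum.swap) (simp add: sum_distrib_right)
  finally have rel: "(\<Sum>j\<le>card B. c j * f ^ j) = 0" using c(3) by simp
  \<comment> \<open>By minimality of \<open>m\<close> every surviving term has the right factor
    \<open>f ^ m\<close>. Cancelling it leaves \<open>c m\<close> plus a left multiple of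
    \<open>f\<close>.\<close>
  define m where "m = (LEAST j. c j \<noteq> 0)"
  obtain i where i: "i \<le> card B" "c i \<noteq> 0" using c(2) by blast
  have m: "c m \<noteq> 0" "m \<le> card B"
    unfolding m_def by (rule LeastI, rule i) (meson i Least_le order.trans)
  have m_least: "c j = 0" if "j < m" for j
    using not_less_Least that unfolding m_def by blast
  have "(\<Sum>j\<le>card B. c j * f ^ j) = (\<Sum>j\<in>{m..card B}. c j * f ^ j)"
    using m_least by (intro sum.mono_neutral_right) (auto simp: not_le)
  also have "\<dots> = c m * f ^ m + (\<Sum>j\<in>{Suc m..card B}. c j * f ^ j)"
    using m(2) by (rule sum.atLeast_Suc_atMost)
  also have "(\<Sum>j\<in>{Suc m..card B}. c j * f ^ j) =
      (\<Sum>j\<in>{Suc m..card B}. c j * f ^ (j - Suc m)) * f * f ^ m"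
    unfolding sum_distrib_right
    by (intro sum.cong) (auto simp: mult.assoc simp flip: power_Suc power_add)
  finally have "(c m + (\<Sum>j\<in>{Suc m..card B}. c j * f ^ (j - Suc m)) * f) * f ^ m = 0"
    using rel by (simp add: distrib_right)
  moreover have "f ^ k \<noteq> 0" for k
    using nzd \<open>f \<noteq> 0\<close> by (induction k) auto
  ultimately have "c m + (\<Sum>j\<in>{Suc m..card B}. c j * f ^ (j - Suc m)) * f = 0"
    using nzd by blast
  then have "c m = - (\<Sum>j\<in>{Suc m..card B}. c j * f ^ (j - Suc m)) * f"
    by (simp add: eq_neg_iff_add_eq_0)
  then have "c m \<in> left_ideal f" unfolding left_ideal_def by blast
  then show ?thesis using c(1) m(1) by blast
qed

section \<open>Left ideals, annihilators and bounds\<close>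

lemma left_ideal_mult: "x \<in> left_ideal f \<Longrightarrow> y * x \<in> left_ideal f"
  unfolding left_ideal_def by (auto simp flip: mult.assoc)

lemma left_ideal_self: "f \<in> left_ideal f"
  unfolding left_ideal_def by (auto intro: exI[of _ 1])

lemma left_ideal_zero: "left_ideal 0 = {0}"
  unfolding left_ideal_def by auto

lemma left_ideal_add: "x \<in> left_ideal f \<Longrightarrow> y \<in> left_ideal f \<Longrightarrow> x + y \<in> left_ideal f"
  unfolding left_ideal_def by (auto simp flip: distrib_right)

lemma central_in_ann_quotient:
  assumes "c \<in> ring_center" "c \<in> left_ideal f"
  shows "c \<in> ann_quotient (left_ideal f)"
  unfolding ann_quotient_def using assms left_ideal_mult ring_center_commute by fastforce

lemma ann_quotient_mult:
  "u \<in> ann_quotient (left_ideal f) \<Longrightarrow> y * u \<in> ann_quotient (left_ideal f)"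
  unfolding ann_quotient_def by (auto simp: mult.assoc intro: left_ideal_mult)

text \<open>A central \<open>c\<close> is twosided, and \<open>c * x = x * c\<close> puts it in the
  annihilator as soon as it lies in \<open>left_ideal f\<close>. Only the inclusion of the
  annihilator in \<open>left_ideal c\<close> remains to be checked.\<close>

lemma central_boundI:
  assumes "c \<in> ring_center" "c \<in> left_ideal f"
    and "\<And>u. u \<in> ann_quotient (left_ideal f) \<Longrightarrow> u \<in> left_ideal c"
  shows "is_bound f c"
proof -
  have "left_ideal c = right_ideal c"
    unfolding left_ideal_def right_ideal_def using ring_center_commute[OF assms(1)] by simp
  moreover have "u \<in> ann_quotient (left_ideal f)" if "u \<in> left_ideal c" for u
    using that ann_quotient_mult[OF central_in_ann_quotient[OF assms(1,2)]]
    unfolding left_ideal_def by blast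
  ultimately show ?thesis
    unfolding is_bound_def twosided_def using assms(3) by blast
qed

text \<open>The bound kills in particular the class of 1.\<close>

lemma bound_in_left_ideal:
  assumes "is_bound f b"
  shows "b \<in> left_ideal f"
proof -
  have "b \<in> ann_quotient (left_ideal f)"
    using assms left_ideal_self unfolding is_bound_def by blast
  then have "b * 1 \<in> left_ideal f" unfolding ann_quotient_def by blast
  then show ?thesis by simp
qed

text \<open>A zero bound would make the annihilator trivial, yet it contains a nonzero central
  multiple of \<open>f\<close>.\<close>

lemma bound_nonzero:
  fixes f :: "'r::ring_1"
  assumes "\<And>a b :: 'r. a * b = 0 \<Longrightarrow> a = 0 \<or> b = 0"
    and "free_of_rank_over (ring_center :: 'r set) r"
    and "f \<noteq> 0" "is_bound f b"
  shows "b \<noteq> 0"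
  using nonzero_central_multiple[OF assms(1-3)] central_in_ann_quotient assms(4) left_ideal_zero
  unfolding is_bound_def by (metis singletonD)

section \<open>Splitting a bound\<close>

lemma left_ideal_cancel_central:
  fixes u a b :: "'r::ring_1"
  assumes nzd: "\<And>a b :: 'r. a * b = 0 \<Longrightarrow> a = 0 \<or> b = 0"
    and "a \<in> ring_center" "a \<noteq> 0" "u * a \<in> left_ideal (a * b)"
  shows "u \<in> left_ideal b"
proof -
  obtain x where "u * a = x * (a * b)" using assms(4) unfolding left_ideal_def by blast
  then have "(u - x * b) * a = 0"
    using ring_center_commute[OF assms(2)] by (simp add: left_diff_distrib mult.assoc)
  then have "u = x * b" using nzd assms(3) by fastforce
  then show ?thesis unfolding left_ideal_def by blast
qed

lemma
  fixes f :: "'r::ring_1"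
  assumes nzd: "\<And>a b :: 'r. a * b = 0 \<Longrightarrow> a = 0 \<or> b = 0"
    and a: "a \<in> ring_center" "a \<noteq> 0" and b: "b \<in> ring_center" "b \<noteq> 0"
    and bound: "is_bound f (a * b)" and gcrd: "is_right_gcd f b h"
  shows bound_gcrd: "is_bound h b"
    and in_left_ideal_gcrd: "f \<in> left_ideal h"
    and bound_quotient_gcrd: "f = g * h \<Longrightarrow> is_bound g a"
proof -
  have h: "left_ideal h = {x + y | x y. x \<in> left_ideal f \<and> y \<in> left_ideal b}"
    using gcrd unfolding is_right_gcd_def .
  have zero: "0 \<in> left_ideal x" for x :: 'r unfolding left_ideal_def by (auto intro: exI[of _ 0])
  show fh: "f \<in> left_ideal h" unfolding h using left_ideal_self zero[of b] by force
  have bh: "b \<in> left_ideal h" unfolding h using left_ideal_self zero[of f] by force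
  have ab: "a * b \<in> left_ideal f" using bound by (rule bound_in_left_ideal)
  \<comment> \<open>This inclusion serves two of the claims. On the summand from \<open>b\<close>,
    centrality turns \<open>a * (w * b)\<close> into \<open>w * (a * b)\<close>, a multiple of the
    bound of \<open>f\<close>.\<close>
  have a_h: "a * x \<in> left_ideal f" if "x \<in> left_ideal h" for x
  proof -
    obtain y w where x: "x = y + w * b" "y \<in> left_ideal f"
      using \<open>x \<in> left_ideal h\<close> h unfolding left_ideal_def[of b] by blast
    have "a * x = a * y + w * (a * b)"
      using ring_center_commute[OF a(1), of w] by (simp add: x distrib_left flip: mult.assoc)
    then show ?thesis
      using left_ideal_add left_ideal_mult ab x(2) by metis
  qed
  have ann_f: "left_ideal (a * b) = ann_quotient (left_ideal f)"
    using bound unfolding is_bound_def by blast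
  show "is_bound h b"
  proof (rule central_boundI[OF b(1) bh])
    fix u assume "u \<in> ann_quotient (left_ideal h)"
    then have "a * (u * x) \<in> left_ideal f" for x
      using a_h unfolding ann_quotient_def by blast
    \<comment> \<open>Here \<open>(u * a) * x\<close> is rewritten as \<open>a * (u * x)\<close>.
      The annihilator of \<open>f\<close> is generated by \<open>a * b\<close>, so cancelling
      \<open>a\<close> leaves \<open>u\<close> in \<open>left_ideal b\<close>.\<close>
    then have "u * a \<in> ann_quotient (left_ideal f)"
      unfolding ann_quotient_def using ring_center_commute[OF a(1), of u]
      by (simp flip: mult.assoc)
    then show "u \<in> left_ideal b"
      using left_ideal_cancel_central[OF nzd a] ann_f by blast
  qed
  show "is_bound g a" if f: "f = g * h"
  proof (rule central_boundI[OF a(1)])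
    have "h \<noteq> 0" using bh b(2) left_ideal_zero by auto
    obtain x where "a * h = x * (g * h)"
      using a_h[OF left_ideal_self] f unfolding left_ideal_def by blast
    then have "(a - x * g) * h = 0" by (simp add: left_diff_distrib mult.assoc)
    then have "a = x * g" using nzd \<open>h \<noteq> 0\<close> by fastforce
    then show "a \<in> left_ideal g" unfolding left_ideal_def by blast
  next
    fix u assume u: "u \<in> ann_quotient (left_ideal g)"
    obtain w where w: "b = w * h" using bh unfolding left_ideal_def by blast
    \<comment> \<open>Centrality gives \<open>u * b * x = u * (x * w) * h\<close>; since
      \<open>u * (x * w)\<close> is a left multiple of \<open>g\<close>, the product is one of
      \<open>g * h = f\<close>.\<close>
    have "(u * b) * x \<in> left_ideal f" for x
    proof -
      have "u * (x * w) \<in> left_ideal g" using u unfolding ann_quotient_def by blast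
      then obtain y where "u * (x * w) = y * g" unfolding left_ideal_def by blast
      then have "u * (x * b) = y * f" by (simp add: f w flip: mult.assoc)
      then show ?thesis
        using ring_center_commute[OF b(1), of x] unfolding left_ideal_def
        by (auto simp: mult.assoc)
    qed
    \<comment> \<open>The order of \<open>a\<close> and \<open>b\<close> is swapped to let the
      cancellation lemma remove \<open>b\<close>.\<close>
    then have "u * b \<in> left_ideal (b * a)"
      using ann_f ring_center_commute[OF a(1), of b] unfolding ann_quotient_def by auto
    then show "u \<in> left_ideal a"
      using left_ideal_cancel_central[OF nzd b] by blast
  qed
qed

section \<open>Correctness of the algorithm\<close>

lemma prod_list_nonzero:
  fixes xs :: "'r::ring_1 list"
  assumes "\<And>a b :: 'r. a * b = 0 \<Longrightarrow> a = 0 \<or> b = 0" "0 \<notin> set xs"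
  shows "prod_list xs \<noteq> 0"
  using assms by (induction xs) fastforce+

lemma prod_list_drop:
  "i < length xs \<Longrightarrow> prod_list (drop i xs) = xs ! i * prod_list (drop (Suc i) xs)"
  using Cons_nth_drop_Suc[of i xs] prod_list.Cons by metis

lemma prod_list_concat: "prod_list (concat xss) = prod_list (map prod_list xss)"
  by (induction xss) simp_all

section \<open>Invariants of the loop for a central factorization of the bound\<close>

context
  fixes gcrd lquo :: "'r \<Rightarrow> 'r \<Rightarrow> 'r::ring_1" and f :: 'r and \<pi>s :: "'r list"
  assumes nzd: "\<And>a b :: 'r. a * b = 0 \<Longrightarrow> a = 0 \<or> b = 0"
    and gcrd: "\<And>g h. is_right_gcd g h (gcrd g h)"
    and lquo: "\<And>g h. g \<in> left_ideal h \<Longrightarrow> g = lquo g h * h"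
    and \<pi>s: "set \<pi>s \<subseteq> ring_center" "0 \<notin> set \<pi>s"
    and bound_f: "is_bound f (prod_list \<pi>s)"
begin

lemma central_nonzero_drop:
  "prod_list (drop i \<pi>s) \<in> ring_center" "prod_list (drop i \<pi>s) \<noteq> 0"
proof -
  have "set (drop i \<pi>s) \<subseteq> ring_center" "0 \<notin> set (drop i \<pi>s)"
    using \<pi>s set_drop_subset[of i \<pi>s] by blast+
  then show "prod_list (drop i \<pi>s) \<in> ring_center" "prod_list (drop i \<pi>s) \<noteq> 0"
    by (simp_all add: ring_center_prod_list prod_list_nonzero nzd)
qed

lemma central_nonzero_nth:
  "i < length \<pi>s \<Longrightarrow> \<pi>s ! i \<in> ring_center" "i < length \<pi>s \<Longrightarrow> \<pi>s ! i \<noteq> 0"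
  using \<pi>s nth_mem[of i \<pi>s] by (blast, metis)

text \<open>Loop invariant: the factors still to be processed multiply to a bound of the current
  polynomial. Each step applies \<open>bound_gcrd\<close> with \<open>a\<close> the current factor
  and \<open>b\<close> the product of the later ones.\<close>

lemma factorize_f_bound:
  "i < length \<pi>s \<Longrightarrow> is_bound (factorize_f gcrd f \<pi>s i) (prod_list (drop i \<pi>s))"
proof (induction i)
  case (Suc i)
  then have "is_bound (factorize_f gcrd f \<pi>s i) (\<pi>s ! i * prod_list (drop (Suc i) \<pi>s))"
    by (simp add: prod_list_drop[of i])
  then show ?case
    using bound_gcrd[OF nzd central_nonzero_nth[of i] central_nonzero_drop _ gcrd] Suc.prems
    by simp
qed (simp add: bound_f)

lemma factorize_step:
  assumes "Suc i < length \<pi>s"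
  shows "factorize_f gcrd f \<pi>s i =
      factorize_g gcrd lquo f \<pi>s i * factorize_f gcrd f \<pi>s (Suc i)"
    and "is_bound (factorize_g gcrd lquo f \<pi>s i) (\<pi>s ! i)"
proof -
  have bound: "is_bound (factorize_f gcrd f \<pi>s i) (\<pi>s ! i * prod_list (drop (Suc i) \<pi>s))"
    using factorize_f_bound[of i] assms by (simp add: prod_list_drop[of i])
  have i: "i < length \<pi>s" using assms by simp
  note split = nzd central_nonzero_nth[OF i] central_nonzero_drop bound gcrd
  show eq: "factorize_f gcrd f \<pi>s i =
      factorize_g gcrd lquo f \<pi>s i * factorize_f gcrd f \<pi>s (Suc i)"
    using lquo[OF in_left_ideal_gcrd[OF split]] assms by (simp add: factorize_g_def)
  show "is_bound (factorize_g gcrd lquo f \<pi>s i) (\<pi>s ! i)"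
    by (rule bound_quotient_gcrd[OF split eq[unfolded factorize_f.simps]])
qed

lemma factorize_g_bound:
  assumes "i < length \<pi>s"
  shows "is_bound (factorize_g gcrd lquo f \<pi>s i) (\<pi>s ! i)"
proof (cases "Suc i < length \<pi>s")
  \<comment> \<open>At the last index the remaining product is the single factor
    \<open>\<pi>s ! i\<close>, and the quotient is defined as the current polynomial itself.\<close>
  case False
  then show ?thesis
    using factorize_f_bound[OF assms] assms
    by (simp add: factorize_g_def prod_list_drop[of i])
qed (rule factorize_step)

lemma prod_list_factorize_g:
  assumes "\<pi>s \<noteq> []"
  shows "prod_list (map (factorize_g gcrd lquo f \<pi>s) [0..<length \<pi>s]) = f"
proof -
  \<comment> \<open>Telescoping: the quotients found so far times the current polynomial give back
    \<open>f\<close>. At the last index the current polynomial is the last quotient, which completes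
    the product.\<close>
  have "prod_list (map (factorize_g gcrd lquo f \<pi>s) [0..<i]) * factorize_f gcrd f \<pi>s i = f"
    if "i < length \<pi>s" for i
    using that
  proof (induction i)
    case (Suc i)
    then show ?case using factorize_step(1)[of i]
      by (simp add: mult.assoc del: factorize_f.simps)
  qed simp
  from this[of "length \<pi>s - 1"] show ?thesis
    using assms by (cases "length \<pi>s") (auto simp: factorize_g_def)
qed

end

theorem theorem5p6:
  fixes \<sigma> \<delta> :: "'d::division_ring \<Rightarrow> 'd"
    and \<iota> :: "'d \<Rightarrow> 'r::ring_1" and X z f :: 'r
    and K :: "'d set" and r :: nat
    and bound :: "'r \<Rightarrow> 'r"
    and factor_Kz :: "'r \<Rightarrow> 'r list"
    and gcrd lquo :: "'r \<Rightarrow> 'r \<Rightarrow> 'r"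
    and factorize_irred :: "'r \<Rightarrow> 'r \<Rightarrow> 'r list"
  assumes ore: "ore_extension \<sigma> \<delta> \<iota> X"
    and free: "free_of_rank_over (ring_center :: 'r set) r"
    and K_subfield: "subfield_of_center K"
    and K_\<sigma>: "\<sigma> ` K \<subseteq> K"
    and K_\<delta>: "\<forall>k\<in>K. \<delta> k = 0"
    and z_nonconst: "ore_degree \<iota> X z > 0"
    and center_eq: "ring_center = polys_in \<iota> K z"
    and twosided_form: "\<forall>p::'r. p \<noteq> 0 \<and> twosided p \<longrightarrow>
          (\<exists>d m. \<exists>\<alpha>\<in>polys_in \<iota> K z. d \<noteq> 0 \<and> p = \<iota> d * (X ^ m * \<alpha>))"
    and bound_correct: "\<forall>g. (\<exists>b\<in>polys_in \<iota> K z. is_bound g b) \<longrightarrow>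
          bound g \<in> polys_in \<iota> K z \<and> is_bound g (bound g)"
    and gcrd_correct: "\<forall>g h. is_right_gcd g h (gcrd g h)"
    and lquo_correct: "\<forall>g h. g \<in> left_ideal h \<longrightarrow> g = lquo g h * h"
    and factor_Kz_correct: "\<forall>\<alpha>\<in>polys_in \<iota> K z. \<alpha> \<noteq> 0 \<and> \<not> unit_in (polys_in \<iota> K z) \<alpha> \<longrightarrow>
          (\<forall>p\<in>set (factor_Kz \<alpha>). irreducible_in (polys_in \<iota> K z) p) \<and>
          \<alpha> = prod_list (factor_Kz \<alpha>)"
    and factorize_irred_correct: "\<forall>g b. is_bound g b \<and> irreducible_in (polys_in \<iota> K z) b \<longrightarrow>
          (\<forall>p\<in>set (factorize_irred g b). irreducible_in UNIV p) \<and>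
          g = prod_list (factorize_irred g b)"
    and f_deg: "ore_degree \<iota> X f > 0"
    and f_bound: "\<exists>b\<in>polys_in \<iota> K z. is_bound f b"
  shows "(\<forall>p\<in>set (factorize bound factor_Kz gcrd lquo factorize_irred f). irreducible_in UNIV p) \<and>
    f = prod_list (factorize bound factor_Kz gcrd lquo factorize_irred f)"
proof -
  interpret ore_extension \<sigma> \<delta> \<iota> X by (rule ore)
  define \<pi>s where "\<pi>s = factor_Kz (bound f)"
  have f0: "f \<noteq> 0" using f_deg by (rule positive_degree_nonzero)
  have bf: "bound f \<in> polys_in \<iota> K z" "is_bound f (bound f)"
    using bound_correct f_bound by blast+
  have bf0: "bound f \<noteq> 0"
    using bound_nonzero[OF ore_no_zero_divisors free f0 bf(2)] .
  \<comment> \<open>If the bound were a unit, then 1 would be a left multiple of \<open>f\<close>,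
    contradicting its positive degree. Nonzero and nonunit are the conditions under which
    \<open>factor_Kz\<close> is correct.\<close>
  have "\<not> unit_in (polys_in \<iota> K z) (bound f)"
  proof
    assume "unit_in (polys_in \<iota> K z) (bound f)"
    then obtain v where "v * bound f = 1" unfolding unit_in_def by blast
    then have "1 \<in> left_ideal f"
      using left_ideal_mult[OF bound_in_left_ideal[OF bf(2)], of v] by simp
    then obtain w where "1 = w * f" unfolding left_ideal_def by blast
    then show False using positive_degree_not_left_invertible[OF f_deg f0, of w] by simp
  qed
  \<comment> \<open>The list is nonempty because an empty product would be 1, a unit.\<close>
  then have irr: "\<And>p. p \<in> set \<pi>s \<Longrightarrow> irreducible_in (polys_in \<iota> K z) p"
    and prod: "bound f = prod_list \<pi>s" and "\<pi>s \<noteq> []"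
    using factor_Kz_correct bf(1) bf0 ring_center_1 center_eq
    unfolding \<pi>s_def unit_in_def by force+
  have \<pi>s: "set \<pi>s \<subseteq> ring_center" "0 \<notin> set \<pi>s"
    using irr unfolding irreducible_in_def center_eq by blast+
  define g where "g = factorize_g gcrd lquo f \<pi>s"
  note ctxt = ore_no_zero_divisors gcrd_correct[rule_format] lquo_correct[rule_format]
    \<pi>s bf(2)[unfolded prod]
  \<comment> \<open>The bound of each quotient is an irreducible factor in the list, which is the
    precondition of \<open>factorize_irred\<close>.\<close>
  have fi: "(\<forall>p\<in>set (factorize_irred (g i) (\<pi>s ! i)). irreducible_in UNIV p) \<and>
      g i = prod_list (factorize_irred (g i) (\<pi>s ! i))" if "i < length \<pi>s" for i
    using factorize_irred_correct factorize_g_bound[OF ctxt that] irr[OF nth_mem[OF that]]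
    unfolding g_def by blast
  have res: "factorize bound factor_Kz gcrd lquo factorize_irred f =
      concat (map (\<lambda>i. factorize_irred (g i) (\<pi>s ! i)) [0..<length \<pi>s])"
    by (simp add: factorize_def Let_def \<pi>s_def g_def)
  have "prod_list (factorize bound factor_Kz gcrd lquo factorize_irred f) =
      prod_list (map g [0..<length \<pi>s])"
    unfolding res prod_list_concat map_map
    using fi by (intro arg_cong[where f = prod_list] map_cong) auto
  also have "\<dots> = f"
    unfolding g_def by (rule prod_list_factorize_g[OF ctxt \<open>\<pi>s \<noteq> []\<close>])
  finally show ?thesis using fi unfolding res by auto
qed

end
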